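(* Let $(X,\Sigma,\mu)$ be a $\sigma$-finite measure space, let $1\le p\le\infty$, $1\le q\le\infty$ with $\frac1p+\frac1q=1$, and let $A:L_p(X,\mu)\to L_p(X,\mu)$, $B:L_p(X,\mu)\to L_p(X,\mu)$ be nonzero operators defined, for almost every $t$, by $$(Ax)(t)=\int_{G_A}\sum_{i=1}^{l_A}a_i(t)c_i(s)x(s)\,d\mu_s,\qquad (Bx)(t)=\int_{G_B}\sum_{j=1}^{l_B}b_j(t)e_j(s)x(s)\,d\mu_s,$$ where $G_A,G_B\in\Sigma$, $l_A,l_B$ are positive integers, $a_i,b_j\in L_p(X,\mu)$, $c_i\in L_q(G_A,\mu)$, $e_j\in L_q(G_B,\mu)$ for $1\le i\le l_A$, $1\le j\le l_B$. Let $H(z)=\sum_{l=0}^{n_h}h_lz^l$ be a polynomial with real coefficients. Put $G=G_A\cap G_B$ and $$\gamma_{i_1}=1,\qquad \gamma_{i_1,\ldots,i_m}=\prod_{l=1}^{m-1}Q_{G_A}(a_{i_{l+1}},c_{i_l}),\quad m\ge2 .$$ Then $BA=H(A)B$ if and only if the following three conditions hold: 1. for almost every $(t,s)\in X\times G$, $$h_0\sum_{k=1}^{l_B}b_k(t)e_k(s)+\sum_{l=1}^{n_h}\sum_{k=1}^{l_B}\sum_{m_1,\ldots,m_l=1}^{l_A}h_l\,\gamma_{m_1,\ldots,m_l}\,a_{m_1}(t)\,Q_{G_A}(b_k,c_{m_l})\,e_k(s)=\sum_{k=1}^{l_B}\sum_{i=1}^{l_A}b_k(t)\,Q_{G_B}(e_k,a_i)\,c_i(s);$$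 2. for almost every $(t,s)\in X\times(G_A\setminus G)$, $$\sum_{k=1}^{l_B}\sum_{i=1}^{l_A}b_k(t)\,Q_{G_B}(e_k,a_i)\,c_i(s)=0;$$ 3. for almost every $(t,s)\in X\times(G_B\setminus G)$, $$-h_0\sum_{k=1}^{l_B}b_k(t)e_k(s)=\sum_{l=1}^{n_h}\sum_{k=1}^{l_B}\sum_{m_1,\ldots,m_l=1}^{l_A}h_l\,\gamma_{m_1,\ldots,m_l}\,Q_{G_A}(b_k,c_{m_l})\,a_{m_1}(t)\,e_k(s).$$
   Context: $L_p(X,\mu)$ is the Banach space of (classes of) real-valued measurable functions $f$ on $X$ with $\int_X|f|^pd\mu<\infty$ (essentially bounded functions if $p=\infty$), and similarly $L_q(\Lambda,\mu)$ for $\Lambda\in\Sigma$. The index in $d\mu_s$ indicates the variable of integration. For $\Lambda\in\Sigma$ and functions $u,v:\Lambda\to\mathbb{R}$ for which the integral exists and is finite, $Q_\Lambda(u,v)=\int_\Lambda u(t)v(t)\,d\mu$. For a polynomial $H(z)=\sum_l h_lz^l$, $H(A)=\sum_l h_lA^l$ with $A^0$ the identity operator. "Almost every $(t,s)$" refers to the product measure $\mu\times\mu$. *)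

theory Defs
  imports "HOL-Analysis.Analysis" "HOL-Computational_Algebra.Polynomial"
begin

text \<open>Elements of \<open>L\<^sub>p\<close> are handled through representatives: \<open>Lp_fun M p\<close> is the set of
  representatives, and two of them are the same element iff they agree almost everywhere.
  The exponent ranges over \<open>[1,\<infinity>]\<close> inside \<^typ>\<open>ennreal\<close>, where \<open>1 / \<infinity> = 0\<close>.\<close>

definition Lp_fun :: "'a measure \<Rightarrow> ennreal \<Rightarrow> ('a \<Rightarrow> real) set" where
  "Lp_fun M p = {f \<in> borel_measurable M.
     if p = \<infinity> then \<exists>C. AE x in M. \<bar>f x\<bar> \<le> C
     else (\<integral>\<^sup>+ x. ennreal (\<bar>f x\<bar> powr enn2real p) \<partial>M) < \<infinity>}"

text \<open>Maps of representatives that induce a map of \<open>L\<^sub>p\<close> into itself.\<close>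

definition Lp_operator :: "'a measure \<Rightarrow> ennreal \<Rightarrow> (('a \<Rightarrow> real) \<Rightarrow> 'a \<Rightarrow> real) \<Rightarrow> bool" where
  "Lp_operator M p T \<longleftrightarrow>
     (\<forall>x\<in>Lp_fun M p. T x \<in> Lp_fun M p) \<and>
     (\<forall>x\<in>Lp_fun M p. \<forall>y\<in>Lp_fun M p. (AE t in M. x t = y t) \<longrightarrow> (AE t in M. T x t = T y t))"

definition Lp_op_eq ::
  "'a measure \<Rightarrow> ennreal \<Rightarrow> (('a \<Rightarrow> real) \<Rightarrow> 'a \<Rightarrow> real) \<Rightarrow> (('a \<Rightarrow> real) \<Rightarrow> 'a \<Rightarrow> real) \<Rightarrow> bool" where
  "Lp_op_eq M p S T \<longleftrightarrow> (\<forall>x\<in>Lp_fun M p. AE t in M. S x t = T x t)"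

definition poly_op :: "real poly \<Rightarrow> (('a \<Rightarrow> real) \<Rightarrow> 'a \<Rightarrow> real) \<Rightarrow> ('a \<Rightarrow> real) \<Rightarrow> 'a \<Rightarrow> real" where
  "poly_op H T x = (\<lambda>t. \<Sum>l\<le>degree H. coeff H l * (T ^^ l) x t)"

definition Q :: "'a measure \<Rightarrow> 'a set \<Rightarrow> ('a \<Rightarrow> real) \<Rightarrow> ('a \<Rightarrow> real) \<Rightarrow> real" where
  "Q M L u v = (LINT t:L|M. u t * v t)"

text \<open>The multi-index \<open>(i\<^sub>1, \<dots>, i\<^sub>m)\<close> is a function on \<open>{1..m}\<close>; for \<open>m = 1\<close> the product is empty.\<close>

definition gamma_coeff ::
  "'a measure \<Rightarrow> 'a set \<Rightarrow> (nat \<Rightarrow> 'a \<Rightarrow> real) \<Rightarrow> (nat \<Rightarrow> 'a \<Rightarrow> real) \<Rightarrow> nat \<Rightarrow> (nat \<Rightarrow> nat) \<Rightarrow> real" where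
  "gamma_coeff M L a c m i = (\<Prod>l=1..m-1. Q M L (a (i (l+1))) (c (i l)))"

end

theory Submission
  imports Defs
begin

text \<open>
  Both \<open>BA\<close> and \<open>H(A)B\<close> have finite rank, and each is an integral operator with a degenerate kernel
  that can be written down. With \<open>\<langle>x, w\<rangle>\<close> for \<open>\<integral> x w d\<mu>\<close>, and with \<open>c\<^sub>i\<close>, \<open>e\<^sub>k\<close> extended by zero from
  \<open>G\<^sub>A\<close>, \<open>G\<^sub>B\<close> to the whole space, \<open>Ax = \<Sum>\<^sub>i \<langle>x, c\<^sub>i\<rangle> a\<^sub>i\<close> and \<open>Bx = \<Sum>\<^sub>k \<langle>x, e\<^sub>k\<rangle> b\<^sub>k\<close>. Composing such sums pairs
  the inner functions with the outer functionals (\<open>pairing_sum_left\<close>), so that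
  \<open>BAx = \<Sum>\<^sub>i \<langle>x, c\<^sub>i\<rangle> v\<^sub>i\<close>, and, after the powers of \<open>A\<close> have been expanded (\<open>finite_rank_funpow\<close>, which is
  where the products \<open>\<gamma>\<close> come from), \<open>H(A)Bx = \<Sum>\<^sub>k \<langle>x, e\<^sub>k\<rangle> u\<^sub>k\<close>.

  Two operators of this form agree iff their kernels agree almost everywhere
  (\<open>finite_rank_ops_eq_iff\<close>). The nontrivial direction is \<open>degenerate_kernel_AE_zero\<close>: a degenerate
  kernel \<open>\<Sum>\<^sub>i u\<^sub>i(t) w\<^sub>i(s)\<close> whose operator kills the indicators of sets of finite measure vanishes almost
  everywhere. This is linear algebra: either all integrals of one \<open>w\<^sub>j\<close> vanish, and then \<open>w\<^sub>j = 0\<close>, or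
  some indicator yields a linear relation that expresses \<open>u\<^sub>j\<close> by the other \<open>u\<^sub>i\<close>; in both cases the
  kernel loses a summand.

  The kernel of \<open>H(A)B\<close> lives on \<open>s \<in> G\<^sub>B\<close>, that of \<open>BA\<close> on \<open>s \<in> G\<^sub>A\<close>. Their equality therefore splits
  into three regions of \<open>s\<close>: on \<open>G\<^sub>A \<inter> G\<^sub>B\<close> both expressions must coincide, and on each of the two
  remaining parts the one kernel that is present must vanish. These are the three conditions.
\<close>

section \<open>The duality pairing\<close>

abbreviation pairing :: "'a measure \<Rightarrow> ('a \<Rightarrow> real) \<Rightarrow> ('a \<Rightarrow> real) \<Rightarrow> real" where
  "pairing M f g \<equiv> LINT t|M. f t * g t"

text \<open>Extension by zero lets the functionals of \<open>A\<close> and of \<open>B\<close>, which live on different sets, be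
  paired with functions on one common space.\<close>

definition zero_ext :: "'a set \<Rightarrow> ('a \<Rightarrow> real) \<Rightarrow> 'a \<Rightarrow> real" where
  "zero_ext L f = (\<lambda>t. indicator L t * f t)"

lemma Q_eq_pairing: "Q M L u v = pairing M u (zero_ext L v)"
  unfolding Q_def set_lebesgue_integral_def zero_ext_def by (simp add: mult_ac)

lemma Q_eq_pairing': "Q M L u v = pairing M v (zero_ext L u)"
  unfolding Q_def set_lebesgue_integral_def zero_ext_def by (simp add: mult_ac)

lemma Lp_fun_measurable: "f \<in> Lp_fun M p \<Longrightarrow> f \<in> borel_measurable M"
  by (simp add: Lp_fun_def)

lemma zero_ext_Lp_fun:
  assumes "G \<in> sets M" and c: "c \<in> Lp_fun (restrict_space M G) q"
  shows "zero_ext G c \<in> Lp_fun M q"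
proof -
  have G: "G \<inter> space M \<in> sets M" using assms by auto
  have meas: "zero_ext G c \<in> borel_measurable M"
    using Lp_fun_measurable[OF c] borel_measurable_restrict_space_iff[OF G, of c]
    by (simp add: zero_ext_def)
  show ?thesis
  proof (cases "q = \<infinity>")
    case True
    then obtain C where "AE x in restrict_space M G. \<bar>c x\<bar> \<le> C"
      using c by (auto simp: Lp_fun_def)
    then have "AE x in M. x \<in> G \<longrightarrow> \<bar>c x\<bar> \<le> C"
      by (simp add: AE_restrict_space_iff[OF G])
    then have "AE x in M. \<bar>zero_ext G c x\<bar> \<le> \<bar>C\<bar>"
      by eventually_elim (auto simp: zero_ext_def indicator_def)
    then show ?thesis using True meas by (auto simp: Lp_fun_def)
  next
    case False
    have "(\<integral>\<^sup>+ x. ennreal (\<bar>zero_ext G c x\<bar> powr enn2real q) \<partial>M)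
        = (\<integral>\<^sup>+ x. ennreal (\<bar>c x\<bar> powr enn2real q) \<partial>restrict_space M G)"
      unfolding nn_integral_restrict_space[OF G]
      by (intro nn_integral_cong) (auto simp: zero_ext_def indicator_def)
    then show ?thesis using False meas c by (auto simp: Lp_fun_def)
  qed
qed

lemma indicator_Lp_fun:
  assumes E: "E \<in> sets M" "emeasure M E < \<infinity>"
  shows "indicator E \<in> Lp_fun M p"
proof (cases "p = \<infinity>")
  case True
  have "AE x in M. \<bar>indicator E x\<bar> \<le> (1::real)" by (auto simp: indicator_def)
  then show ?thesis using True E by (auto simp: Lp_fun_def)
next
  case False
  have "(\<integral>\<^sup>+ x. ennreal (\<bar>indicator E x\<bar> powr enn2real p) \<partial>M) = (\<integral>\<^sup>+ x. indicator E x \<partial>M)"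
    by (intro nn_integral_cong) (auto simp: indicator_def)
  then show ?thesis using False E by (auto simp: Lp_fun_def)
qed

lemma conjugate_exponents_cases:
  fixes p q :: ennreal
  assumes "1 \<le> p" "1 \<le> q" "1 / p + 1 / q = 1"
  obtains "p = \<infinity>" "q = 1" | "p = 1" "q = \<infinity>"
    | r s where "p = ennreal r" "q = ennreal s" "r > 1" "s > 1" "1 / r + 1 / s = 1"
proof -
  have top: "y = 1" if "1 / \<infinity> + 1 / y = 1" "1 \<le> y" for y :: ennreal
  proof (cases y)
    case (real s)
    then have "s \<ge> 1" using that(2) by simp
    then have "ennreal (1 / s) = ennreal 1"
      using that(1) real by (simp add: ennreal_divide_top divide_ennreal flip: ennreal_1)
    then have "1 / s = 1" using \<open>s \<ge> 1\<close> by (subst (asm) ennreal_inj) auto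
    then show ?thesis using real \<open>s \<ge> 1\<close> by (simp add: field_simps)
  next
    case top
    then show ?thesis using that by (simp add: ennreal_divide_top)
  qed
  show thesis
  proof (cases p)
    case p: (real r)
    show thesis
    proof (cases q)
      case q: (real s)
      have rs: "r \<ge> 1" "s \<ge> 1" using p q assms(1,2) by simp_all
      have "ennreal (1 / r + 1 / s) = ennreal 1"
        using assms(3) p q rs
        by (simp add: divide_ennreal flip: ennreal_1 ennreal_plus)
      then have eq: "1 / r + 1 / s = 1"
        using rs by (subst (asm) ennreal_inj) auto
      then have "r \<noteq> 1" "s \<noteq> 1" using rs by auto
      then show thesis using that(3) p q rs eq by simp
    next
      case qtop: top
      then have "p = 1" using top[of p] assms by (simp add: add.commute)
      then show thesis using that(2) qtop by simp
    qed
  next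
    case ptop: top
    then have "q = 1" using top[of q] assms by simp
    then show thesis using that(1) ptop by simp
  qed
qed

lemma Lp_fun_one_integrable:
  assumes "f \<in> Lp_fun M 1" shows "integrable M f"
proof (rule integrableI_bounded)
  show "f \<in> borel_measurable M" by (rule Lp_fun_measurable[OF assms])
  show "(\<integral>\<^sup>+ x. ennreal (norm (f x)) \<partial>M) < \<infinity>"
    using assms by (simp add: Lp_fun_def)
qed

lemma Lp_fun_infty_mult_integrable:
  assumes f: "f \<in> Lp_fun M \<infinity>" and g: "integrable M g"
  shows "integrable M (\<lambda>t. f t * g t)"
proof -
  obtain C where C: "AE t in M. \<bar>f t\<bar> \<le> C" using f by (auto simp: Lp_fun_def)
  show ?thesis
  proof (rule Bochner_Integration.integrable_bound)
    show "integrable M (\<lambda>t. C * g t)" using g by simp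
    show "(\<lambda>t. f t * g t) \<in> borel_measurable M"
      using Lp_fun_measurable[OF f] g by auto
    show "AE t in M. norm (f t * g t) \<le> norm (C * g t)"
      using C by eventually_elim (auto simp: abs_mult intro!: mult_right_mono)
  qed
qed

lemma Lp_fun_powr_integrable:
  assumes f: "f \<in> Lp_fun M (ennreal r)" and "0 \<le> r"
  shows "integrable M (\<lambda>t. \<bar>f t\<bar> powr r)"
proof (rule integrableI_bounded)
  show "(\<lambda>t. \<bar>f t\<bar> powr r) \<in> borel_measurable M" using Lp_fun_measurable[OF f] by auto
  show "(\<integral>\<^sup>+ x. ennreal (norm (\<bar>f x\<bar> powr r)) \<partial>M) < \<infinity>"
    using f \<open>0 \<le> r\<close> by (simp add: Lp_fun_def)
qed

text \<open>The qualitative part of Hoelder's inequality. Away from the endpoint exponents, Young's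
  inequality bounds the product by an integrable function directly, without normalisation.\<close>

lemma Lp_fun_mult_integrable:
  assumes pq: "1 \<le> p" "1 \<le> q" "1 / p + 1 / q = 1"
    and f: "f \<in> Lp_fun M p" and g: "g \<in> Lp_fun M q"
  shows "integrable M (\<lambda>t. f t * g t)"
  using pq
proof (cases rule: conjugate_exponents_cases)
  case 1
  then show ?thesis using f g by (auto intro: Lp_fun_infty_mult_integrable Lp_fun_one_integrable)
next
  case 2
  then have "integrable M (\<lambda>t. g t * f t)"
    using f g by (auto intro: Lp_fun_infty_mult_integrable Lp_fun_one_integrable)
  then show ?thesis by (simp add: mult.commute)
next
  case (3 r s)
  show ?thesis
  proof (rule Bochner_Integration.integrable_bound)
    show "integrable M (\<lambda>t. \<bar>f t\<bar> powr r / r + \<bar>g t\<bar> powr s / s)"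
      using f g 3 by (intro Bochner_Integration.integrable_add integrable_divide
          Lp_fun_powr_integrable) auto
    show "(\<lambda>t. f t * g t) \<in> borel_measurable M"
      using Lp_fun_measurable[OF f] Lp_fun_measurable[OF g] by simp
    show "AE t in M. norm (f t * g t) \<le> norm (\<bar>f t\<bar> powr r / r + \<bar>g t\<bar> powr s / s)"
      using Youngs_inequality[OF 3(3-5)] 3(3,4)
      by (auto simp: abs_mult intro!: AE_I2 order_trans[OF _ abs_ge_self])
  qed
qed

text \<open>The rule by which finite-rank operators are composed: \<open>y\<close> is the image under the inner operator,
  known only almost everywhere, and \<open>g\<close> is a functional of the outer one.\<close>

lemma pairing_sum_left:
  assumes y: "y \<in> borel_measurable M" and g: "g \<in> borel_measurable M"
    and int: "\<And>i. i \<in> I \<Longrightarrow> integrable M (\<lambda>t. f i t * g t)"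
    and eq: "AE t in M. y t = (\<Sum>i\<in>I. f i t * r i)"
  shows "pairing M y g = (\<Sum>i\<in>I. r i * pairing M (f i) g)"
proof -
  have "pairing M y g = (LINT t|M. (\<Sum>i\<in>I. r i * (f i t * g t)))"
  proof (rule integral_cong_AE)
    show "(\<lambda>t. y t * g t) \<in> borel_measurable M" using y g by auto
    show "(\<lambda>t. \<Sum>i\<in>I. r i * (f i t * g t)) \<in> borel_measurable M"
      using int by (intro borel_measurable_sum borel_measurable_integrable) auto
    show "AE t in M. y t * g t = (\<Sum>i\<in>I. r i * (f i t * g t))"
      using eq by eventually_elim (simp add: sum_distrib_left sum_distrib_right mult_ac)
  qed
  also have "\<dots> = (\<Sum>i\<in>I. r i * pairing M (f i) g)"
    using int by (subst Bochner_Integration.integral_sum) auto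
  finally show ?thesis .
qed

lemma set_LINT_degenerate_kernel:
  assumes "\<And>i. i \<in> I \<Longrightarrow> integrable M (\<lambda>s. x s * zero_ext L (g i) s)"
  shows "(LINT s:L|M. (\<Sum>i\<in>I. r i * g i s * x s)) = (\<Sum>i\<in>I. r i * pairing M x (zero_ext L (g i)))"
proof -
  have "(LINT s:L|M. (\<Sum>i\<in>I. r i * g i s * x s))
      = (LINT s|M. (\<Sum>i\<in>I. r i * (x s * zero_ext L (g i) s)))"
    unfolding set_lebesgue_integral_def
    by (intro Bochner_Integration.integral_cong refl) (simp add: zero_ext_def sum_distrib_left mult_ac)
  then show ?thesis using assms by (simp add: Bochner_Integration.integral_sum)
qed

section \<open>Kernels of finite-rank integral operators\<close>

text \<open>Since \<open>w\<close> need not be integrable, it is cut off to the members of an exhaustion by sets of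
  finite measure, where an integrable function is determined by its integrals.\<close>

lemma AE_zero_if_pairing_indicator_zero:
  assumes "sigma_finite_measure M"
    and int: "\<And>E. E \<in> sets M \<Longrightarrow> emeasure M E < \<infinity> \<Longrightarrow> integrable M (\<lambda>t. indicator E t * w t)"
    and zero: "\<And>E. E \<in> sets M \<Longrightarrow> emeasure M E < \<infinity> \<Longrightarrow> pairing M (indicator E) w = 0"
  shows "AE s in M. w s = 0"
proof -
  interpret sigma_finite_measure M by fact
  obtain S :: "nat \<Rightarrow> 'a set" where S: "range S \<subseteq> sets M" "(\<Union>n. S n) = space M"
    "\<And>n. emeasure M (S n) \<noteq> \<infinity>" using sigma_finite by blast
  have "AE s in M. indicator (S n) s * w s = 0" for n
  proof (rule density_unique_real)
    have Sn: "S n \<in> sets M" "emeasure M (S n) < \<infinity>"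
      using S(1) S(3)[of n] by (auto simp: top.not_eq_extremum)
    show "integrable M (\<lambda>s. indicator (S n) s * w s)" by (rule int[OF Sn])
    show "integrable M (\<lambda>s. 0 :: real)" by simp
    fix E assume E: "E \<in> sets M"
    have "emeasure M (E \<inter> S n) < \<infinity>"
      using Sn by (meson emeasure_mono inf_le2 le_less_trans)
    then have "pairing M (indicator (E \<inter> S n)) w = 0"
      using zero E Sn by blast
    then show "(LINT s:E|M. indicator (S n) s * w s) = (LINT s:E|M. 0)"
      unfolding set_lebesgue_integral_def by (simp add: indicator_inter_arith mult.assoc)
  qed
  then have "AE s in M. \<forall>n. indicator (S n) s * w s = 0"
    unfolding AE_all_countable by blast
  then show ?thesis
  proof (rule AE_mp, intro AE_I2 impI)
    fix s assume "s \<in> space M" "\<forall>n. indicator (S n) s * w s = 0"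
    moreover from this obtain n where "s \<in> S n" using S(2) by blast
    ultimately show "w s = 0" by (metis indicator_simps(1) mult_1)
  qed
qed

text \<open>Induction on the number of summands. The exceptional null set of \<open>t\<close> may depend on the test set
  \<open>E\<close>, of which there are uncountably many; the induction, which removes one summand at a time,
  needs the null set of only one test set in each step.\<close>

lemma degenerate_kernel_AE_zero:
  fixes M :: "'a measure" and N :: "'b measure" and u :: "'i \<Rightarrow> 'b \<Rightarrow> real"
  assumes "sigma_finite_measure M" and "finite I"
    and "\<And>i E. i \<in> I \<Longrightarrow> E \<in> sets M \<Longrightarrow> emeasure M E < \<infinity> \<Longrightarrow>
           integrable M (\<lambda>s. indicator E s * w i s)"
    and "\<And>E. E \<in> sets M \<Longrightarrow> emeasure M E < \<infinity> \<Longrightarrow>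
           AE t in N. (\<Sum>i\<in>I. u i t * pairing M (indicator E) (w i)) = 0"
  shows "AE t in N. AE s in M. (\<Sum>i\<in>I. u i t * w i s) = 0"
  using assms(2-)
proof (induction I arbitrary: w rule: finite_induct)
  case empty
  then show ?case by simp
next
  case (insert j J)
  show ?case
  proof (cases "\<exists>E. E \<in> sets M \<and> emeasure M E < \<infinity> \<and> pairing M (indicator E) (w j) \<noteq> 0")
    case True
    then obtain E where E: "E \<in> sets M" "emeasure M E < \<infinity>"
      and nz: "pairing M (indicator E) (w j) \<noteq> 0" by blast
    \<comment> \<open>The test set \<open>E\<close> gives a linear relation between the \<open>u\<^sub>i\<close>, solved here for \<open>u\<^sub>j\<close>;
      substituting it moves multiples of \<open>w\<^sub>j\<close> into the other \<open>w\<^sub>i\<close>.\<close>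
    define \<alpha> where "\<alpha> i = - pairing M (indicator E) (w i) / pairing M (indicator E) (w j)" for i
    define w' where "w' i s = w i s + \<alpha> i * w j s" for i s
    have uj: "AE t in N. u j t = (\<Sum>i\<in>J. \<alpha> i * u i t)"
      using insert.prems(2)[OF E]
    proof eventually_elim
      case (elim t)
      then have "u j t * pairing M (indicator E) (w j)
          = - (\<Sum>i\<in>J. u i t * pairing M (indicator E) (w i))"
        using insert.hyps by simp
      then have "u j t = - (\<Sum>i\<in>J. u i t * pairing M (indicator E) (w i))
          / pairing M (indicator E) (w j)"
        by (metis nz nonzero_mult_div_cancel_right)
      then show ?case
        by (simp add: \<alpha>_def sum_divide_distrib mult.commute sum_negf)
    qed
    have collapse: "(\<Sum>i\<in>J. u i t * (r i + \<alpha> i * r j)) = (\<Sum>i\<in>insert j J. u i t * r i)"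
      if "u j t = (\<Sum>i\<in>J. \<alpha> i * u i t)" for t and r :: "'i \<Rightarrow> real"
      using insert.hyps that
      by (simp add: algebra_simps sum.distrib sum_distrib_left)
    have "AE t in N. AE s in M. (\<Sum>i\<in>J. u i t * w' i s) = 0"
    proof (rule insert.IH)
      fix F assume F: "F \<in> sets M" "emeasure M F < \<infinity>"
      have int: "integrable M (\<lambda>s. indicator F s * w i s)" if "i \<in> insert j J" for i
        by (rule insert.prems(1)[OF that F])
      have split: "indicator F s * w' i s = indicator F s * w i s + \<alpha> i * (indicator F s * w j s)"
        for i s by (simp add: w'_def algebra_simps)
      show "integrable M (\<lambda>s. indicator F s * w' i s)" if "i \<in> J" for i
        unfolding split using int that by simp
      have "pairing M (indicator F) (w' i)
          = pairing M (indicator F) (w i) + \<alpha> i * pairing M (indicator F) (w j)" if "i \<in> J" for i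
        unfolding split using int that by simp
      then show "AE t in N. (\<Sum>i\<in>J. u i t * pairing M (indicator F) (w' i)) = 0"
        using insert.prems(2)[OF F] uj
          collapse[where r = "\<lambda>i. pairing M (indicator F) (w i)"]
        by (auto elim!: eventually_elim2)
    qed
    then show ?thesis
      using uj
    proof eventually_elim
      case (elim t)
      then show ?case
        using collapse[OF elim(2), where r = "\<lambda>i. w i s" for s] by (simp add: w'_def)
    qed
  next
    case False
    then have zero: "pairing M (indicator E) (w j) = 0"
      if "E \<in> sets M" "emeasure M E < \<infinity>" for E using that by blast
    have wj: "AE s in M. w j s = 0"
      by (rule AE_zero_if_pairing_indicator_zero[OF assms(1)]) (use insert.prems(1) zero in auto)
    have "AE t in N. AE s in M. (\<Sum>i\<in>J. u i t * w i s) = 0"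
    proof (rule insert.IH)
      fix F assume F: "F \<in> sets M" "emeasure M F < \<infinity>"
      show "integrable M (\<lambda>s. indicator F s * w i s)" if "i \<in> J" for i
        using insert.prems(1) F that by blast
      show "AE t in N. (\<Sum>i\<in>J. u i t * pairing M (indicator F) (w i)) = 0"
        using insert.prems(2)[OF F] insert.hyps zero[OF F] by simp
    qed
    then show ?thesis
    proof eventually_elim
      case (elim t)
      then show ?case using wj by eventually_elim (use insert.hyps in simp)
    qed
  qed
qed

text \<open>From left to right it suffices to test with indicators of sets of finite measure, which belong to
  every \<open>L\<^sub>p\<close>; from right to left the kernel is integrated against \<open>x\<close> for almost every fixed \<open>t\<close>.\<close>

lemma finite_rank_eq_zero_iff:
  fixes M :: "'a measure" and p q :: ennreal and u w :: "'i \<Rightarrow> 'a \<Rightarrow> real"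
  assumes sf: "sigma_finite_measure M"
    and pq: "1 \<le> p" "1 \<le> q" "1 / p + 1 / q = 1"
    and fin: "finite I"
    and u: "\<And>i. i \<in> I \<Longrightarrow> u i \<in> borel_measurable M"
    and w: "\<And>i. i \<in> I \<Longrightarrow> w i \<in> Lp_fun M q"
  shows "(\<forall>x\<in>Lp_fun M p. AE t in M. (\<Sum>i\<in>I. u i t * pairing M x (w i)) = 0) \<longleftrightarrow>
         (AE (t, s) in M \<Otimes>\<^sub>M M. (\<Sum>i\<in>I. u i t * w i s) = 0)"
    (is "?op \<longleftrightarrow> ?kernel")
proof -
  interpret pair_sigma_finite M M by (simp add: pair_sigma_finite_def sf)
  have w_meas: "w i \<in> borel_measurable M" if "i \<in> I" for i
    using w[OF that] by (rule Lp_fun_measurable)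
  have int: "integrable M (\<lambda>s. x s * w i s)" if "x \<in> Lp_fun M p" "i \<in> I" for x i
    using Lp_fun_mult_integrable[OF pq that(1) w[OF that(2)]] .
  show ?thesis
  proof
    assume ?op
    have "AE t in M. AE s in M. (\<Sum>i\<in>I. u i t * w i s) = 0"
      by (rule degenerate_kernel_AE_zero[OF sf fin])
        (use \<open>?op\<close> int in \<open>auto simp: indicator_Lp_fun\<close>)
    then show ?kernel
      using u w_meas by (intro AE_pair_measure) auto
  next
    assume ?kernel
    then have kernel: "AE t in M. AE s in M. (\<Sum>i\<in>I. u i t * w i s) = 0"
      by (auto dest!: AE_pair)
    show ?op
    proof
      fix x assume x: "x \<in> Lp_fun M p"
      show "AE t in M. (\<Sum>i\<in>I. u i t * pairing M x (w i)) = 0"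
        using kernel
      proof eventually_elim
        case (elim t)
        have "(\<Sum>i\<in>I. u i t * pairing M x (w i)) = (LINT s|M. (\<Sum>i\<in>I. u i t * (x s * w i s)))"
          using int[OF x] by (subst Bochner_Integration.integral_sum) auto
        also have "\<dots> = (LINT s|M. 0)"
        proof (rule integral_cong_AE)
          show "(\<lambda>s. \<Sum>i\<in>I. u i t * (x s * w i s)) \<in> borel_measurable M"
            using int[OF x] by (intro borel_measurable_sum borel_measurable_integrable) auto
          show "AE s in M. (\<Sum>i\<in>I. u i t * (x s * w i s)) = 0"
            using elim
          proof eventually_elim
            case (elim s)
            have "(\<Sum>i\<in>I. u i t * (x s * w i s)) = x s * (\<Sum>i\<in>I. u i t * w i s)"
              by (simp add: sum_distrib_left mult_ac)
            then show ?case using elim by simp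
          qed
        qed simp
        finally show ?case by simp
      qed
    qed
  qed
qed

lemma finite_rank_ops_eq_iff:
  fixes M :: "'a measure" and p q :: ennreal
    and u w :: "'i \<Rightarrow> 'a \<Rightarrow> real" and v z :: "'j \<Rightarrow> 'a \<Rightarrow> real"
  assumes sf: "sigma_finite_measure M"
    and pq: "1 \<le> p" "1 \<le> q" "1 / p + 1 / q = 1"
    and fin: "finite I" "finite J"
    and u: "\<And>i. i \<in> I \<Longrightarrow> u i \<in> borel_measurable M"
    and v: "\<And>j. j \<in> J \<Longrightarrow> v j \<in> borel_measurable M"
    and w: "\<And>i. i \<in> I \<Longrightarrow> w i \<in> Lp_fun M q"
    and z: "\<And>j. j \<in> J \<Longrightarrow> z j \<in> Lp_fun M q"
    and S: "\<And>x. x \<in> Lp_fun M p \<Longrightarrow> AE t in M. S x t = (\<Sum>i\<in>I. u i t * pairing M x (w i))"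
    and T: "\<And>x. x \<in> Lp_fun M p \<Longrightarrow> AE t in M. T x t = (\<Sum>j\<in>J. v j t * pairing M x (z j))"
  shows "Lp_op_eq M p S T \<longleftrightarrow>
    (AE (t, s) in M \<Otimes>\<^sub>M M. (\<Sum>i\<in>I. u i t * w i s) = (\<Sum>j\<in>J. v j t * z j s))"
proof -
  \<comment> \<open>The difference of the two operators is again of finite rank, indexed by the disjoint sum.\<close>
  define U where "U = case_sum u (\<lambda>j t. - v j t)"
  define W where "W = case_sum w z"
  have sum_UW: "(\<Sum>k\<in>I <+> J. U k t * f (W k)) = (\<Sum>i\<in>I. u i t * f (w i)) - (\<Sum>j\<in>J. v j t * f (z j))"
    for t and f :: "('a \<Rightarrow> real) \<Rightarrow> real"
    by (simp add: sum.Plus[OF fin] U_def W_def sum_negf)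
  have "Lp_op_eq M p S T \<longleftrightarrow>
    (\<forall>x\<in>Lp_fun M p. AE t in M. (\<Sum>k\<in>I <+> J. U k t * pairing M x (W k)) = 0)"
    unfolding Lp_op_eq_def
  proof (rule ball_cong[OF refl])
    fix x assume x: "x \<in> Lp_fun M p"
    have "AE t in M. S x t = T x t \<longleftrightarrow> (\<Sum>k\<in>I <+> J. U k t * pairing M x (W k)) = 0"
      using S[OF x] T[OF x] by eventually_elim (simp add: sum_UW[of _ "pairing M x"])
    then show "(AE t in M. S x t = T x t) \<longleftrightarrow>
        (AE t in M. (\<Sum>k\<in>I <+> J. U k t * pairing M x (W k)) = 0)"
      by (rule eventually_cong)
  qed
  also have "\<dots> \<longleftrightarrow> (AE (t, s) in M \<Otimes>\<^sub>M M. (\<Sum>k\<in>I <+> J. U k t * W k s) = 0)"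
  proof (rule finite_rank_eq_zero_iff[OF sf pq])
    show "U k \<in> borel_measurable M" if "k \<in> I <+> J" for k
      using that u v by (auto simp: U_def)
    show "W k \<in> Lp_fun M q" if "k \<in> I <+> J" for k
      using that w z by (auto simp: W_def)
  qed (use fin in simp)
  also have "\<dots> \<longleftrightarrow>
      (AE (t, s) in M \<Otimes>\<^sub>M M. (\<Sum>i\<in>I. u i t * w i s) = (\<Sum>j\<in>J. v j t * z j s))"
    using sum_UW[of _ "\<lambda>g. g s" for s] by simp
  finally show ?thesis .
qed

section \<open>Powers and polynomials of a finite-rank operator\<close>

lemma sum_PiE_atLeastAtMost_Suc:
  fixes F :: "(nat \<Rightarrow> 'i) \<Rightarrow> real"
  shows "(\<Sum>m\<in>{1..Suc l} \<rightarrow>\<^sub>E I. F m) = (\<Sum>m\<in>{1..l} \<rightarrow>\<^sub>E I. \<Sum>j\<in>I. F (m(Suc l := j)))"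
proof -
  have "(\<Sum>m\<in>{1..Suc l} \<rightarrow>\<^sub>E I. F m)
      = (\<Sum>m\<in>(\<lambda>(j, m). m(Suc l := j)) ` (I \<times> ({1..l} \<rightarrow>\<^sub>E I)). F m)"
    by (simp add: atLeastAtMostSuc_conv PiE_insert_eq)
  also have "\<dots> = (\<Sum>(j, m)\<in>I \<times> ({1..l} \<rightarrow>\<^sub>E I). F (m(Suc l := j)))"
    by (subst sum.reindex[OF inj_combinator]) (auto simp: case_prod_unfold)
  also have "\<dots> = (\<Sum>m\<in>{1..l} \<rightarrow>\<^sub>E I. \<Sum>j\<in>I. F (m(Suc l := j)))"
    by (subst sum.cartesian_product[symmetric], subst sum.swap) simp
  finally show ?thesis .
qed

text \<open>Writing \<open>A\<^sup>l\<^sup>+\<^sup>1 y = A\<^sup>l (A y)\<close> makes each step append an index at the end of the multi-index: the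
  functional \<open>w (m l)\<close> meets the new function \<open>a j\<close>, which yields the new factor of the product, and
  the leading function \<open>a (m 1)\<close> stays in place.\<close>

lemma finite_rank_funpow:
  fixes M :: "'a measure" and a w :: "'i \<Rightarrow> 'a \<Rightarrow> real"
  assumes pq: "1 \<le> p" "1 \<le> q" "1 / p + 1 / q = 1"
    and a: "\<And>i. i \<in> I \<Longrightarrow> a i \<in> Lp_fun M p" and w: "\<And>i. i \<in> I \<Longrightarrow> w i \<in> Lp_fun M q"
    and op: "Lp_operator M p A"
    and A: "\<And>x. x \<in> Lp_fun M p \<Longrightarrow> AE t in M. A x t = (\<Sum>i\<in>I. a i t * pairing M x (w i))"
    and "1 \<le> l" and "y \<in> Lp_fun M p"
  shows "AE t in M. (A ^^ l) y t = (\<Sum>m\<in>{1..l} \<rightarrow>\<^sub>E I.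
    (\<Prod>k=1..l-1. pairing M (a (m (k+1))) (w (m k))) * a (m 1) t * pairing M y (w (m l)))"
  using assms(8,9)
proof (induction l arbitrary: y rule: nat_induct_at_least)
  case base
  then show ?case
    using A[OF base] sum_PiE_atLeastAtMost_Suc[where l=0 and I=I] by simp
next
  case (Suc l)
  let ?\<gamma> = "\<lambda>l m. \<Prod>k=1..l-1. pairing M (a (m (k+1))) (w (m k))"
  have Ay: "A y \<in> Lp_fun M p" using op Suc.prems by (simp add: Lp_operator_def)
  have pair: "pairing M (A y) (w i) = (\<Sum>j\<in>I. pairing M y (w j) * pairing M (a j) (w i))"
    if "i \<in> I" for i
    using A[OF Suc.prems] Lp_fun_mult_integrable[OF pq a w[OF that]] Lp_fun_measurable[OF Ay]
      Lp_fun_measurable[OF w[OF that]]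
    by (intro pairing_sum_left) auto
  have append: "?\<gamma> (Suc l) (m(Suc l := j)) = ?\<gamma> l m * pairing M (a j) (w (m l))" for m j
  proof -
    obtain l' where l': "l = Suc l'" using Suc.hyps by (cases l) auto
    show ?thesis by (simp add: l')
  qed
  have "AE t in M. (A ^^ l) (A y) t
      = (\<Sum>m\<in>{1..l} \<rightarrow>\<^sub>E I. ?\<gamma> l m * a (m 1) t * pairing M (A y) (w (m l)))"
    by (rule Suc.IH[OF Ay])
  then show ?case
  proof eventually_elim
    case (elim t)
    have "(A ^^ Suc l) y t = (A ^^ l) (A y) t" by (simp add: funpow_swap1)
    also have "\<dots> = (\<Sum>m\<in>{1..l} \<rightarrow>\<^sub>E I. \<Sum>j\<in>I.
        ?\<gamma> l m * a (m 1) t * (pairing M y (w j) * pairing M (a j) (w (m l))))"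
      unfolding elim
    proof (rule sum.cong[OF refl])
      fix m assume "m \<in> {1..l} \<rightarrow>\<^sub>E I"
      then have "m l \<in> I" using Suc.hyps by auto
      then show "?\<gamma> l m * a (m 1) t * pairing M (A y) (w (m l)) = (\<Sum>j\<in>I.
          ?\<gamma> l m * a (m 1) t * (pairing M y (w j) * pairing M (a j) (w (m l))))"
        by (simp only: pair sum_distrib_left)
    qed
    also have "\<dots> = (\<Sum>m\<in>{1..Suc l} \<rightarrow>\<^sub>E I.
        ?\<gamma> (Suc l) m * a (m 1) t * pairing M y (w (m (Suc l))))"
      unfolding sum_PiE_atLeastAtMost_Suc append
      using Suc.hyps by (intro sum.cong refl) (simp add: mult_ac)
    finally show ?case .
  qed
qed

text \<open>The bound \<open>n\<close> may exceed the degree, because leading coefficients \<open>h l\<close> may vanish; the constant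
  term is split off since the expansion of powers needs \<open>l \<ge> 1\<close>.\<close>

lemma poly_op_sum_monom:
  assumes "H = (\<Sum>l=0..n. monom (h l) l)"
  shows "poly_op H T x t = h 0 * x t + (\<Sum>l=1..n. h l * (T ^^ l) x t)"
proof -
  have coeff: "coeff H l = (if l \<le> n then h l else 0)" for l
    by (simp add: assms coeff_sum sum.delta)
  then have "degree H \<le> n" by (intro degree_le) auto
  then have "poly_op H T x t = (\<Sum>l\<le>n. coeff H l * (T ^^ l) x t)"
    unfolding poly_op_def by (intro sum.mono_neutral_left) (auto simp: coeff_eq_0)
  also have "\<dots> = (\<Sum>l\<le>n. h l * (T ^^ l) x t)" by (simp add: coeff)
  also have "\<dots> = h 0 * x t + (\<Sum>l=1..n. h l * (T ^^ l) x t)"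
    by (simp add: atMost_atLeast0 sum.atLeast_Suc_atMost)
  finally show ?thesis .
qed

section \<open>The commutation criterion\<close>

text \<open>The case distinction on the position of \<open>s\<close> behind the three conditions; outside both sets
  the equation holds trivially.\<close>

lemma indicator_kernels_eq_iff:
  fixes r \<eta> b n :: real
  shows "indicator A s * r = indicator B s * (\<eta> * b + n) \<longleftrightarrow>
    (s \<in> A \<inter> B \<longrightarrow> \<eta> * b + n = r) \<and> (s \<in> A - A \<inter> B \<longrightarrow> r = 0) \<and> (s \<in> B - A \<inter> B \<longrightarrow> - \<eta> * b = n)"
  by (auto simp: indicator_def)

theorem corollary2:
  fixes M :: "'a measure" and p q :: ennreal
    and A B :: "('a \<Rightarrow> real) \<Rightarrow> 'a \<Rightarrow> real"
    and GA GB G :: "'a set" and lA lB nh :: nat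
    and a b c e :: "nat \<Rightarrow> 'a \<Rightarrow> real"
    and H :: "real poly" and h :: "nat \<Rightarrow> real"
  assumes "sigma_finite_measure M"
    and "1 \<le> p" and "1 \<le> q" and "1 / p + 1 / q = 1"
    and "GA \<in> sets M" and "GB \<in> sets M"
    and "1 \<le> lA" and "1 \<le> lB"
    and "\<And>i. i \<in> {1..lA} \<Longrightarrow> a i \<in> Lp_fun M p"
    and "\<And>j. j \<in> {1..lB} \<Longrightarrow> b j \<in> Lp_fun M p"
    and "\<And>i. i \<in> {1..lA} \<Longrightarrow> c i \<in> Lp_fun (restrict_space M GA) q"
    and "\<And>j. j \<in> {1..lB} \<Longrightarrow> e j \<in> Lp_fun (restrict_space M GB) q"
    and "Lp_operator M p A" and "Lp_operator M p B"
    and "\<And>x. x \<in> Lp_fun M p \<Longrightarrow>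
           AE t in M. A x t = (LINT s:GA|M. (\<Sum>i=1..lA. a i t * c i s * x s))"
    and "\<And>x. x \<in> Lp_fun M p \<Longrightarrow>
           AE t in M. B x t = (LINT s:GB|M. (\<Sum>j=1..lB. b j t * e j s * x s))"
    and "\<not> Lp_op_eq M p A (\<lambda>x t. 0)" and "\<not> Lp_op_eq M p B (\<lambda>x t. 0)"
    and "H = (\<Sum>l=0..nh. monom (h l) l)"
    and "G = GA \<inter> GB"
  shows "Lp_op_eq M p (B \<circ> A) (poly_op H A \<circ> B) \<longleftrightarrow>
    (AE (t, s) in M \<Otimes>\<^sub>M M. (t, s) \<in> space M \<times> G \<longrightarrow>
       h 0 * (\<Sum>k=1..lB. b k t * e k s)
       + (\<Sum>l=1..nh. \<Sum>k=1..lB. \<Sum>m\<in>{1..l} \<rightarrow>\<^sub>E {1..lA}.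
            h l * gamma_coeff M GA a c l m * a (m 1) t * Q M GA (b k) (c (m l)) * e k s)
       = (\<Sum>k=1..lB. \<Sum>i=1..lA. b k t * Q M GB (e k) (a i) * c i s)) \<and>
    (AE (t, s) in M \<Otimes>\<^sub>M M. (t, s) \<in> space M \<times> (GA - G) \<longrightarrow>
       (\<Sum>k=1..lB. \<Sum>i=1..lA. b k t * Q M GB (e k) (a i) * c i s) = 0) \<and>
    (AE (t, s) in M \<Otimes>\<^sub>M M. (t, s) \<in> space M \<times> (GB - G) \<longrightarrow>
       - h 0 * (\<Sum>k=1..lB. b k t * e k s)
       = (\<Sum>l=1..nh. \<Sum>k=1..lB. \<Sum>m\<in>{1..l} \<rightarrow>\<^sub>E {1..lA}.
            h l * gamma_coeff M GA a c l m * Q M GA (b k) (c (m l)) * a (m 1) t * e k s))"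
proof -
  note sf = assms(1) and pq = assms(2-4) and GA = assms(5) and GB = assms(6)
    and a = assms(9) and b = assms(10) and opA = assms(13) and opB = assms(14)
    and G = assms(20)
  define c' where "c' i = zero_ext GA (c i)" for i
  define e' where "e' k = zero_ext GB (e k)" for k
  have c': "c' i \<in> Lp_fun M q" if "i \<in> {1..lA}" for i
    unfolding c'_def by (rule zero_ext_Lp_fun[OF GA assms(11)[OF that]])
  have e': "e' k \<in> Lp_fun M q" if "k \<in> {1..lB}" for k
    unfolding e'_def by (rule zero_ext_Lp_fun[OF GB assms(12)[OF that]])
  note int = Lp_fun_mult_integrable[OF pq]
  have A: "AE t in M. A x t = (\<Sum>i=1..lA. a i t * pairing M x (c' i))" if x: "x \<in> Lp_fun M p" for x
  proof -
    have "(LINT s:GA|M. (\<Sum>i=1..lA. a i t * c i s * x s))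
        = (\<Sum>i=1..lA. a i t * pairing M x (c' i))" for t
      unfolding c'_def by (rule set_LINT_degenerate_kernel) (use int[OF x c'] in \<open>simp add: c'_def\<close>)
    then show ?thesis using assms(15)[OF x] by simp
  qed
  have B: "AE t in M. B x t = (\<Sum>k=1..lB. b k t * pairing M x (e' k))" if x: "x \<in> Lp_fun M p" for x
  proof -
    have "(LINT s:GB|M. (\<Sum>k=1..lB. b k t * e k s * x s))
        = (\<Sum>k=1..lB. b k t * pairing M x (e' k))" for t
      unfolding e'_def by (rule set_LINT_degenerate_kernel) (use int[OF x e'] in \<open>simp add: e'_def\<close>)
    then show ?thesis using assms(16)[OF x] by simp
  qed
  have AxL: "A x \<in> Lp_fun M p" and BxL: "B x \<in> Lp_fun M p" if "x \<in> Lp_fun M p" for x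
    using opA opB that by (simp_all add: Lp_operator_def)

  \<comment> \<open>The range functions of \<open>BA\<close> (along the functionals of \<open>A\<close>) and of \<open>H(A)B\<close> (along those
    of \<open>B\<close>).\<close>
  define v where "v i t = (\<Sum>k=1..lB. b k t * Q M GB (e k) (a i))" for i t
  define u where "u k t = h 0 * b k t + (\<Sum>l=1..nh. \<Sum>m\<in>{1..l} \<rightarrow>\<^sub>E {1..lA}.
      h l * gamma_coeff M GA a c l m * a (m 1) t * Q M GA (b k) (c (m l)))" for k t

  have BA: "AE t in M. (B \<circ> A) x t = (\<Sum>i=1..lA. v i t * pairing M x (c' i))"
    if x: "x \<in> Lp_fun M p" for x
  proof -
    have pair: "pairing M (A x) (e' k)
        = (\<Sum>i=1..lA. pairing M x (c' i) * Q M GB (e k) (a i))" if k: "k \<in> {1..lB}" for k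
      unfolding Q_eq_pairing' e'_def[symmetric]
      using A[OF x] int[OF a e'[OF k]] Lp_fun_measurable[OF AxL[OF x]]
        Lp_fun_measurable[OF e'[OF k]]
      by (intro pairing_sum_left) auto
    show ?thesis
      using B[OF AxL[OF x]]
    proof eventually_elim
      case (elim t)
      have "(B \<circ> A) x t = (\<Sum>k=1..lB. \<Sum>i=1..lA.
          b k t * (pairing M x (c' i) * Q M GB (e k) (a i)))"
        by (simp add: elim pair sum_distrib_left)
      also have "\<dots> = (\<Sum>i=1..lA. v i t * pairing M x (c' i))"
        by (subst sum.swap) (simp add: v_def sum_distrib_right sum_distrib_left mult_ac)
      finally show ?case .
    qed
  qed

  have HAB: "AE t in M. (poly_op H A \<circ> B) x t = (\<Sum>k=1..lB. u k t * pairing M x (e' k))"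
    if x: "x \<in> Lp_fun M p" for x
  proof -
    have pair: "pairing M (B x) (c' i)
        = (\<Sum>k=1..lB. pairing M x (e' k) * Q M GA (b k) (c i))" if i: "i \<in> {1..lA}" for i
      unfolding Q_eq_pairing c'_def[symmetric]
      using B[OF x] int[OF b c'[OF i]] Lp_fun_measurable[OF BxL[OF x]]
        Lp_fun_measurable[OF c'[OF i]]
      by (intro pairing_sum_left) auto
    have "AE t in M. \<forall>l\<in>{1..nh}. (A ^^ l) (B x) t = (\<Sum>m\<in>{1..l} \<rightarrow>\<^sub>E {1..lA}.
        gamma_coeff M GA a c l m * a (m 1) t * pairing M (B x) (c' (m l)))"
      unfolding gamma_coeff_def Q_eq_pairing c'_def[symmetric]
      by (intro AE_finite_allI finite_rank_funpow[OF pq a c' opA A] BxL x) auto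
    then show ?thesis
      using B[OF x]
    proof eventually_elim
      case (elim t)
      have pow: "h l * (A ^^ l) (B x) t = (\<Sum>k=1..lB. \<Sum>m\<in>{1..l} \<rightarrow>\<^sub>E {1..lA}.
          h l * gamma_coeff M GA a c l m * a (m 1) t * Q M GA (b k) (c (m l)) * pairing M x (e' k))"
        if l: "l \<in> {1..nh}" for l
      proof -
        have "h l * (A ^^ l) (B x) t = (\<Sum>m\<in>{1..l} \<rightarrow>\<^sub>E {1..lA}.
            h l * (gamma_coeff M GA a c l m * a (m 1) t * pairing M (B x) (c' (m l))))"
          using elim(1) l by (simp add: sum_distrib_left)
        also have "\<dots> = (\<Sum>m\<in>{1..l} \<rightarrow>\<^sub>E {1..lA}. \<Sum>k=1..lB.
          h l * gamma_coeff M GA a c l m * a (m 1) t * Q M GA (b k) (c (m l)) * pairing M x (e' k))"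
        proof (rule sum.cong[OF refl])
          fix m assume "m \<in> {1..l} \<rightarrow>\<^sub>E {1..lA}"
          then have "m l \<in> {1..lA}" using l by (auto dest: PiE_mem[of _ _ _ l])
          then show "h l * (gamma_coeff M GA a c l m * a (m 1) t * pairing M (B x) (c' (m l)))
              = (\<Sum>k=1..lB. h l * gamma_coeff M GA a c l m * a (m 1) t * Q M GA (b k) (c (m l))
                  * pairing M x (e' k))"
            unfolding pair[OF \<open>m l \<in> {1..lA}\<close>] sum_distrib_left by (simp add: mult_ac)
        qed
        finally show ?thesis by (subst sum.swap)
      qed
      have "(poly_op H A \<circ> B) x t
          = h 0 * (\<Sum>k=1..lB. b k t * pairing M x (e' k)) + (\<Sum>l=1..nh. h l * (A ^^ l) (B x) t)"
        by (simp add: poly_op_sum_monom[OF assms(19)] elim(2))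
      also have "\<dots> = (\<Sum>k=1..lB. u k t * pairing M x (e' k))"
      proof -
        have "(\<Sum>l=1..nh. h l * (A ^^ l) (B x) t) = (\<Sum>l=1..nh. \<Sum>k=1..lB.
            (\<Sum>m\<in>{1..l} \<rightarrow>\<^sub>E {1..lA}. h l * gamma_coeff M GA a c l m * a (m 1) t
              * Q M GA (b k) (c (m l))) * pairing M x (e' k))"
          by (intro sum.cong refl) (simp only: pow sum_distrib_right)
        also have "\<dots> = (\<Sum>k=1..lB. \<Sum>l=1..nh.
            (\<Sum>m\<in>{1..l} \<rightarrow>\<^sub>E {1..lA}. h l * gamma_coeff M GA a c l m * a (m 1) t
              * Q M GA (b k) (c (m l))) * pairing M x (e' k))"
          by (rule sum.swap)
        finally show ?thesis
          by (simp only: u_def distrib_right sum.distrib sum_distrib_left sum_distrib_right mult.assoc)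
      qed
      finally show ?case .
    qed
  qed

  have u_meas: "u k \<in> borel_measurable M" if "k \<in> {1..lB}" for k
    unfolding u_def[abs_def]
    by (intro borel_measurable_add borel_measurable_sum borel_measurable_times
        borel_measurable_const Lp_fun_measurable[OF b] Lp_fun_measurable[OF a] that)
      (auto dest: PiE_mem[of _ _ _ "Suc 0"])
  have v_meas: "v i \<in> borel_measurable M" for i
    unfolding v_def[abs_def]
    by (intro borel_measurable_sum borel_measurable_times
        borel_measurable_const Lp_fun_measurable[OF b])

  have BA_kernel: "(\<Sum>i=1..lA. v i t * c' i s)
      = indicator GA s * (\<Sum>k=1..lB. \<Sum>i=1..lA. b k t * Q M GB (e k) (a i) * c i s)" for t s
    unfolding v_def c'_def zero_ext_def
    by (subst sum.swap) (simp add: sum_distrib_left sum_distrib_right mult_ac)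
  have HAB_kernel: "(\<Sum>k=1..lB. u k t * e' k s)
      = indicator GB s * (h 0 * (\<Sum>k=1..lB. b k t * e k s)
         + (\<Sum>l=1..nh. \<Sum>k=1..lB. \<Sum>m\<in>{1..l} \<rightarrow>\<^sub>E {1..lA}.
            h l * gamma_coeff M GA a c l m * a (m 1) t * Q M GA (b k) (c (m l)) * e k s))" for t s
  proof -
    have "(\<Sum>l=1..nh. \<Sum>k=1..lB. \<Sum>m\<in>{1..l} \<rightarrow>\<^sub>E {1..lA}.
            h l * gamma_coeff M GA a c l m * a (m 1) t * Q M GA (b k) (c (m l)) * e k s)
        = (\<Sum>k=1..lB. \<Sum>l=1..nh. \<Sum>m\<in>{1..l} \<rightarrow>\<^sub>E {1..lA}.
            h l * gamma_coeff M GA a c l m * a (m 1) t * Q M GA (b k) (c (m l)) * e k s)"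
      by (rule sum.swap)
    also have "h 0 * (\<Sum>k=1..lB. b k t * e k s) + \<dots> = (\<Sum>k=1..lB. u k t * e k s)"
      by (simp only: u_def distrib_right sum.distrib sum_distrib_left sum_distrib_right mult.assoc)
    finally show ?thesis
      by (simp add: e'_def zero_ext_def sum_distrib_left mult.left_commute)
  qed

  let ?R = "\<lambda>t s. \<Sum>k=1..lB. \<Sum>i=1..lA. b k t * Q M GB (e k) (a i) * c i s"
  let ?L = "\<lambda>t s. h 0 * (\<Sum>k=1..lB. b k t * e k s)
       + (\<Sum>l=1..nh. \<Sum>k=1..lB. \<Sum>m\<in>{1..l} \<rightarrow>\<^sub>E {1..lA}.
            h l * gamma_coeff M GA a c l m * a (m 1) t * Q M GA (b k) (c (m l)) * e k s)"
  let ?N = "\<lambda>t s. \<Sum>l=1..nh. \<Sum>k=1..lB. \<Sum>m\<in>{1..l} \<rightarrow>\<^sub>E {1..lA}.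
            h l * gamma_coeff M GA a c l m * Q M GA (b k) (c (m l)) * a (m 1) t * e k s"
  have "Lp_op_eq M p (B \<circ> A) (poly_op H A \<circ> B) \<longleftrightarrow>
      (AE (t, s) in M \<Otimes>\<^sub>M M. (\<Sum>i=1..lA. v i t * c' i s) = (\<Sum>k=1..lB. u k t * e' k s))"
    by (rule finite_rank_ops_eq_iff[OF sf pq _ _ v_meas u_meas c' e' BA HAB]) auto
  also have "\<dots> \<longleftrightarrow>
      (AE (t, s) in M \<Otimes>\<^sub>M M. ((t, s) \<in> space M \<times> G \<longrightarrow> ?L t s = ?R t s) \<and>
        ((t, s) \<in> space M \<times> (GA - G) \<longrightarrow> ?R t s = 0) \<and>
        ((t, s) \<in> space M \<times> (GB - G) \<longrightarrow> - h 0 * (\<Sum>k=1..lB. b k t * e k s) = ?N t s))"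
  proof (rule AE_cong)
    fix z assume "z \<in> space (M \<Otimes>\<^sub>M M)"
    then obtain t s where z: "z = (t, s)" "t \<in> space M" by (auto simp: space_pair_measure)
    have LN: "?L t s = h 0 * (\<Sum>k=1..lB. b k t * e k s) + ?N t s"
      by (simp add: mult_ac)
    show "(case z of (t, s) \<Rightarrow> (\<Sum>i=1..lA. v i t * c' i s) = (\<Sum>k=1..lB. u k t * e' k s)) \<longleftrightarrow>
      (case z of (t, s) \<Rightarrow> ((t, s) \<in> space M \<times> G \<longrightarrow> ?L t s = ?R t s) \<and>
        ((t, s) \<in> space M \<times> (GA - G) \<longrightarrow> ?R t s = 0) \<and>
        ((t, s) \<in> space M \<times> (GB - G) \<longrightarrow> - h 0 * (\<Sum>k=1..lB. b k t * e k s) = ?N t s))"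
      unfolding z(1) prod.case BA_kernel HAB_kernel LN
      by (simp only: indicator_kernels_eq_iff G mem_Times_iff fst_conv snd_conv z(2) simp_thms)
  qed
  finally show ?thesis by (simp only: AE_conj_iff case_prod_unfold)
qed

end
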